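(* Let $X$ be a standard normal random vector in $\mathbb{R}^n$. Let $T \subset \mathbb{R}^n$ be a nonempty highly symmetric set with $\rho(T)>0$ and let $u>0$ be any number. Assume that $$0 \le r \le 2\bar{w}(T) - \frac{u}{\rho(T)}.$$ Then for any Borel set $A \subset \mathbb{R}^n$ we have $$\mathbb{P}\{X \in A-rT\} \ge \mathbb{P}\{X \in A\} - e^{-u^2/8}.$$
   Context: For $x \in \mathbb{R}^n$, $\mathrm{supp}(x)=\{i : x_i \ne 0\}$. A set $T \subset \mathbb{R}^n$ is called highly symmetric if, whenever $T$ contains a point $x$, the set $T$ also contains every point $y \in \mathbb{R}^n$ that satisfies $\mathrm{supp}(y)=\mathrm{supp}(x)$ and $\|y\|_2 \ge \|x\|_2$. For a nonempty set $T \subset \mathbb{R}^n\setminus\{0\}$, the scaled Gaussian width is $$\bar{w}(T) = \mathbb{E} \sup_{t \in T} \left\langle X, \frac{t}{\|t\|_2^2}\right\rangle,$$ where $X$ is a standard normal random vector in $\mathbb{R}^n$, and the inradius of $T$ is $\rho(T) = \inf_{t \in T} \|t\|_2$. For $A,T\subset\mathbb{R}^n$ and $r\in\mathbb{R}$, $A-rT = \{a-rt : a\in A,\ t\in T\}$. If $A-rT$ is not Borel, $\mathbb{P}\{X\in A-rT\}$ is understood as outer probability. *)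

theory Defs
  imports "HOL-Probability.Probability"
begin

definition vec_supp :: "real ^ 'n \<Rightarrow> 'n set" where
  "vec_supp x = {i. x $ i \<noteq> 0}"

definition highly_symmetric :: "(real ^ 'n) set \<Rightarrow> bool" where
  "highly_symmetric T \<longleftrightarrow>
     (\<forall>x\<in>T. \<forall>y. vec_supp y = vec_supp x \<and> norm y \<ge> norm x \<longrightarrow> y \<in> T)"

definition std_normal_vec_density :: "real ^ 'n \<Rightarrow> real" where
  "std_normal_vec_density x = (\<Prod>i\<in>UNIV. std_normal_density (x $ i))"

definition std_normal_vec :: "'a measure \<Rightarrow> ('a \<Rightarrow> real ^ 'n) \<Rightarrow> bool" where
  "std_normal_vec M X \<longleftrightarrow>
     distributed M lborel X (\<lambda>x. ennreal (std_normal_vec_density x))"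

definition std_gaussian :: "(real ^ 'n) measure" where
  "std_gaussian = density lborel (\<lambda>x. ennreal (std_normal_vec_density x))"

definition inradius :: "(real ^ 'n) set \<Rightarrow> real" where
  "inradius T = (INF t\<in>T. norm t)"

(* The expectation depends only on the law of X, so it is taken over std_gaussian.
   The definition is meant for nonempty T with inradius T > 0: the supremum at x is then
   bounded by norm x / inradius T in absolute value and is lower semicontinuous in x,
   so it is integrable. If inradius T = 0, the real-valued supremum may be a dummy value. *)
definition scaled_gaussian_width :: "(real ^ 'n) set \<Rightarrow> real" where
  "scaled_gaussian_width T =
     (\<integral>x. (SUP t\<in>T. x \<bullet> (t /\<^sub>R (norm t)\<^sup>2)) \<partial>std_gaussian)"

definition diff_scaled :: "(real ^ 'n) set \<Rightarrow> real \<Rightarrow> (real ^ 'n) set \<Rightarrow> (real ^ 'n) set" where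
  "diff_scaled A r T = {a - r *\<^sub>R t | a t. a \<in> A \<and> t \<in> T}"

(* The least measure of an event containing E. On events it is the probability itself. *)
definition outer_prob :: "'a measure \<Rightarrow> 'a set \<Rightarrow> real" where
  "outer_prob M E = enn2real (outer_measure_of M E)"

end

theory Submission
  imports Defs
begin

text \<open>
  Write \<open>x\<^sub>S\<close> for the restriction of \<open>x\<close> to the coordinates in \<open>S\<close>. Flipping the signs of the
  coordinates of \<open>x\<close> in \<open>S\<close> moves \<open>x\<close> by \<open>2 x\<^sub>S\<close> and preserves the Gaussian measure, even if \<open>S\<close>
  depends on \<open>x\<close> through the absolute values of its coordinates. If all coordinates of \<open>x\<close> are
  nonzero and \<open>2 f x > r\<close>, where \<open>f x = (SUP t\<in>T. x \<bullet> (t /\<^sub>R (norm t)\<^sup>2))\<close>, then for some such choice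
  of \<open>S\<close> the displacement \<open>2 x\<^sub>S\<close> lies in \<open>r T\<close>, because \<open>T\<close> is highly symmetric. Hence the measure
  of \<open>A - r T\<close> is at least that of \<open>A\<close> minus that of \<open>{x. 2 f x \<le> r}\<close>. As \<open>f\<close> is Lipschitz with constant
  \<open>1 / inradius T\<close>, the latter is at most \<open>exp (- u\<^sup>2 / 8)\<close> by Gaussian concentration.

  Concentration with the sharp constant follows from the dual form of Talagrand's transport inequality:
  if \<open>g x - f y \<le> (norm (x - y))\<^sup>2 / 2\<close> for all \<open>x\<close> and \<open>y\<close>, then the integral of \<open>exp g\<close> is at most the
  exponential of the integral of \<open>f\<close>. In dimension one it follows by monotone transport on \<open>[-R, R]\<close>, and it
  tensorizes.
\<close>

subsection \<open>The transport inequality in dimension one\<close>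

text \<open>With \<open>P\<close> and \<open>Q\<close> the primitives of \<open>p\<close> and
  \<open>q\<close> from \<open>a\<close>, the map is the inverse of \<open>Q\<close> composed with
  \<open>P\<close>. Equal total masses make it fix both end points, and the derivative is the chain
  rule together with the inverse function rule.\<close>

lemma monotone_transport_interval:
  fixes p q :: "real \<Rightarrow> real"
  assumes ab: "a < b"
    and p: "continuous_on {a..b} p" "\<And>x. x \<in> {a..b} \<Longrightarrow> 0 < p x"
    and q: "continuous_on {a..b} q" "\<And>x. x \<in> {a..b} \<Longrightarrow> 0 < q x"
    and mass: "integral {a..b} p = integral {a..b} q"
  obtains T where "continuous_on {a..b} T" "T a = a" "T b = b"
    "\<And>x. x \<in> {a<..<b} \<Longrightarrow> (T has_real_derivative p x / q (T x)) (at x)"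
proof -
  have deriv: "((\<lambda>x. integral {a..x} w) has_real_derivative w x) (at x)"
    if "continuous_on {a..b} w" "x \<in> {a<..<b}" for w :: "real \<Rightarrow> real" and x
    using integral_has_real_derivative[OF that(1), of x] that(2)
    by (simp add: at_within_Icc_at)
  have cont: "continuous_on {a..b} (\<lambda>x. integral {a..x} w)"
    if "continuous_on {a..b} w" for w :: "real \<Rightarrow> real"
    by (intro indefinite_integral_continuous_1 integrable_continuous_real that)
  have incr: "integral {a..x} w < integral {a..y} w"
    if "continuous_on {a..b} w" "\<And>x. x \<in> {a..b} \<Longrightarrow> 0 < w x" "a \<le> x" "x < y" "y \<le> b"
    for w :: "real \<Rightarrow> real" and x y
  proof (rule DERIV_pos_imp_increasing_open[OF \<open>x < y\<close>])
    show "\<exists>d. ((\<lambda>x. integral {a..x} w) has_real_derivative d) (at z) \<and> 0 < d"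
      if "x < z" "z < y" for z
      using deriv[of w z] that \<open>a \<le> x\<close> \<open>y \<le> b\<close> \<open>continuous_on {a..b} w\<close>
        \<open>\<And>x. x \<in> {a..b} \<Longrightarrow> 0 < w x\<close>[of z] by force
    show "continuous_on {x..y} (\<lambda>x. integral {a..x} w)"
      by (rule continuous_on_subset[OF cont]) (use that in auto)
  qed
  define P where "P x = integral {a..x} p" for x
  define Q where "Q x = integral {a..x} q" for x
  have P_cont: "continuous_on {a..b} P" and Q_cont: "continuous_on {a..b} Q"
    unfolding P_def Q_def by (intro cont p q)+
  have P_incr: "P x < P y" and Q_incr: "Q x < Q y" if "a \<le> x" "x < y" "y \<le> b" for x y
    unfolding P_def Q_def by (intro incr p q that; simp)+
  have PQ: "P a = 0" "Q a = 0" "P b = Q b" by (simp_all add: P_def Q_def mass)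
  have inj: "inj_on Q {a..b}"
    by (rule linorder_inj_onI) (use Q_incr in force)+
  define T where "T = the_inv_into {a..b} Q \<circ> P"
  have range: "P x \<in> Q ` {a..b}" if "x \<in> {a..b}" for x
  proof -
    have "0 \<le> P x" "P x \<le> P b"
      using P_incr[of a x] P_incr[of x b] that PQ by (force simp: le_less)+
    then show ?thesis
      using IVT'[of Q a "P x" b] PQ Q_cont ab by force
  qed
  have T_in: "T x \<in> {a..b}" and QT: "Q (T x) = P x" if "x \<in> {a..b}" for x
    unfolding T_def using the_inv_into_into[OF inj range[OF that] order_refl] 
      f_the_inv_into_f[OF inj range[OF that]] by auto
  have T_eq: "T x = y" if "x \<in> {a..b}" "y \<in> {a..b}" "Q y = P x" for x y
    using the_inv_into_f_f[OF inj that(2)] that(3) by (simp add: T_def)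
  have T_cont: "continuous_on {a..b} T"
    unfolding T_def
  proof (rule continuous_on_compose[OF P_cont])
    have "continuous_on (Q ` {a..b}) (the_inv_into {a..b} Q)"
      by (rule continuous_on_inv[OF Q_cont]) (auto simp: the_inv_into_f_f[OF inj])
    then show "continuous_on (P ` {a..b}) (the_inv_into {a..b} Q)"
      by (rule continuous_on_subset) (use range in auto)
  qed
  have Ta: "T a = a" and Tb: "T b = b"
    using PQ ab by (auto intro!: T_eq)
  have T_incr: "T x < T y" if "a \<le> x" "x < y" "y \<le> b" for x y
  proof (rule ccontr)
    assume "\<not> T x < T y"
    then have "T y < T x \<or> T x = T y" by auto
    then have "Q (T y) \<le> Q (T x)"
      using Q_incr[of "T y" "T x"] T_in[of x] T_in[of y] that by force
    then show False using QT[of x] QT[of y] P_incr[of x y] that by auto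
  qed
  show thesis
  proof (rule that[OF T_cont Ta Tb])
    fix x assume x: "x \<in> {a<..<b}"
    \<comment> \<open>Strict monotonicity keeps \<open>T x\<close> off the end points, so
      \<open>Q\<close> has a two-sided derivative there.\<close>
    have Tx: "T x \<in> {a<..<b}"
      using T_incr[of a x] T_incr[of x b] x Ta Tb by auto
    let ?I = "the_inv_into {a..b} Q"
    have "P x \<in> {Q a<..<Q b}"
      using P_incr[of a x] P_incr[of x b] x PQ by auto
    have QIcc: "{Q a..Q b} \<subseteq> Q ` {a..b}"
      using IVT'[of Q a _ b] Q_cont ab by force
    \<comment> \<open>The inverse function rule asks for continuity of the inverse; it comes from
      compactness of the interval.\<close>
    have I_cont: "continuous_on {Q a<..<Q b} ?I"
      by (rule continuous_on_subset[OF continuous_on_inv[OF Q_cont]])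
        (use QIcc in \<open>auto simp: the_inv_into_f_f[OF inj]\<close>)
    have "(?I has_real_derivative inverse (q (T x))) (at (P x))"
    proof (rule DERIV_inverse_function[where f = Q and a = "Q a" and b = "Q b"])
      show "(Q has_real_derivative q (T x)) (at (?I (P x)))"
        using deriv[OF q(1) Tx] by (simp add: Q_def[abs_def] T_def)
      show "q (T x) \<noteq> 0" using q(2)[of "T x"] Tx by force
      show "Q (?I y) = y" if "Q a < y" "y < Q b" for y
        by (rule f_the_inv_into_f[OF inj]) (use QIcc that in auto)
      show "isCont ?I (P x)"
        using I_cont \<open>P x \<in> {Q a<..<Q b}\<close> by (simp add: continuous_on_eq_continuous_at)
    qed (use \<open>P x \<in> {Q a<..<Q b}\<close> in auto)
    moreover have "(P has_real_derivative p x) (at x)"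
      using deriv[OF p(1) x] by (simp add: P_def[abs_def])
    ultimately have "(?I \<circ> P has_real_derivative inverse (q (T x)) * p x) (at x)"
      by (intro DERIV_chain)
    then show "(T has_real_derivative p x / q (T x)) (at x)"
      unfolding T_def by (simp add: divide_inverse mult.commute)
  qed
qed

lemma std_normal_density_has_derivative:
  "(std_normal_density has_real_derivative - x * std_normal_density x) (at x within S)"
  unfolding std_normal_density_def[abs_def]
  by (auto intro!: derivative_eq_intros simp: field_simps)

lemma continuous_on_std_normal_density [continuous_intros]:
  "continuous_on S f \<Longrightarrow> continuous_on S (\<lambda>x. std_normal_density (f x))"
  unfolding std_normal_density_def by (intro continuous_intros) auto

text \<open>The transport map \<open>T\<close> fixes the end points, so \<open>(T x - x) * std_normal_density x\<close> vanishes
  there. Its derivative dominates the difference of the two sides by \<open>T' - 1 \<ge> ln T'\<close>.\<close>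

lemma inf_convolution_gaussian_interval:
  fixes f g :: "real \<Rightarrow> real"
  assumes R: "0 < R"
    and f: "continuous_on {-R..R} f" and g: "continuous_on {-R..R} g"
    and fg: "\<And>x y. g x - f y \<le> (x - y)\<^sup>2 / 2"
  defines "m \<equiv> integral {-R..R} std_normal_density"
    and "Z \<equiv> integral {-R..R} (\<lambda>x. exp (g x) * std_normal_density x)"
  shows "m * ln (Z / m) \<le> integral {-R..R} (\<lambda>x. f x * std_normal_density x)" "0 < m" "0 < Z"
proof -
  let ?\<phi> = std_normal_density
  have pos: "0 < integral {-R..R} w"
    if w: "continuous_on {-R..R} w" "\<And>x. 0 < w x" for w :: "real \<Rightarrow> real"
    using integral_less_real[OF continuous_on_const[of "{-R..R}" 0] w(1)] w(2) R by simp
  have \<phi>_cont: "continuous_on {-R..R} ?\<phi>" by (intro continuous_intros)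
  have g\<phi>_cont: "continuous_on {-R..R} (\<lambda>x. exp (g x) * ?\<phi> x)" by (intro continuous_intros g)
  show m: "0 < m" unfolding m_def by (intro pos \<phi>_cont) (simp add: normal_density_pos)
  show Z: "0 < Z" unfolding Z_def by (intro pos g\<phi>_cont) (simp add: normal_density_pos)
  \<comment> \<open>The density tilted by \<open>exp g\<close>, rescaled to have the Gaussian mass
    \<open>m\<close> of the interval, as transport requires equal masses.\<close>
  define q where "q x = m / Z * (exp (g x) * ?\<phi> x)" for x
  have q_pos: "0 < q x" for x using m Z by (simp add: q_def normal_density_pos)
  have q_mass: "integral {-R..R} q = m"
    using Z unfolding q_def by (simp add: Z_def[symmetric])
  obtain T where T: "continuous_on {-R..R} T" "T (-R) = -R" "T R = R"
    "\<And>x. x \<in> {-R<..<R} \<Longrightarrow> (T has_real_derivative ?\<phi> x / q (T x)) (at x)"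
  proof (rule monotone_transport_interval[of "-R" R ?\<phi> q])
    show "continuous_on {-R..R} q" unfolding q_def by (intro continuous_intros g)
    show "integral {-R..R} ?\<phi> = integral {-R..R} q" by (simp add: q_mass m_def)
  qed (use R q_pos \<phi>_cont in \<open>auto simp: normal_density_pos\<close>)
  let ?h = "\<lambda>x. (T x - x) * ?\<phi> x"
  let ?h' = "\<lambda>x. (?\<phi> x / q (T x) - 1) * ?\<phi> x + (T x - x) * (- x * ?\<phi> x)"
  \<comment> \<open>\<open>T\<close> is known to be differentiable only inside the interval, hence
    the interior form of the fundamental theorem.\<close>
  have "(?h' has_integral (?h R - ?h (-R))) {-R..R}"
  proof (rule fundamental_theorem_of_calculus_interior)
    show "continuous_on {-R..R} ?h" by (intro continuous_intros T)
    show "(?h has_vector_derivative ?h' x) (at x)" if "x \<in> {-R<..<R}" for x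
      unfolding has_real_derivative_iff_has_vector_derivative[symmetric]
      by (rule derivative_eq_intros T(4)[OF that] std_normal_density_has_derivative refl)+
         (simp add: algebra_simps)
  qed (use R in simp)
  then have h': "(?h' has_integral 0) {-R..R}" using T by simp
  have le: "ln (Z / m) * ?\<phi> x - f x * ?\<phi> x \<le> ?h' x" for x
  proof -
    have "exp ((T x)\<^sup>2 / 2 - x\<^sup>2 / 2 - g (T x)) = exp (- x\<^sup>2 / 2 - (g (T x) + - (T x)\<^sup>2 / 2))"
      by (rule arg_cong[of _ _ exp]) simp
    also have "\<dots> = exp (- x\<^sup>2 / 2) / (exp (g (T x)) * exp (- (T x)\<^sup>2 / 2))"
      by (simp only: exp_diff exp_add)
    finally have T': "?\<phi> x / q (T x) = Z / m * exp ((T x)\<^sup>2 / 2 - x\<^sup>2 / 2 - g (T x))"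
      using Z m by (simp add: q_def std_normal_density_def divide_simps)
    have "ln (?\<phi> x / q (T x)) = ln (Z / m) + ((T x)\<^sup>2 / 2 - x\<^sup>2 / 2 - g (T x))"
      unfolding T' using Z m by (subst ln_mult) auto
    moreover have "ln (?\<phi> x / q (T x)) \<le> ?\<phi> x / q (T x) - 1"
      by (rule ln_le_minus_one) (use q_pos in \<open>simp add: normal_density_pos\<close>)
    \<comment> \<open>The hypothesis \<open>fg\<close> bounds \<open>g (T x) - f x\<close> by this
      square. Its cross term is exactly what the derivative of the Gaussian density contributes to
      \<open>?h'\<close>.\<close>
    moreover have "(T x - x)\<^sup>2 / 2 = (T x)\<^sup>2 / 2 - x\<^sup>2 / 2 - (T x - x) * x"
      by (simp add: power2_eq_square algebra_simps diff_divide_distrib add_divide_distrib)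
    ultimately have "ln (Z / m) - f x \<le> (?\<phi> x / q (T x) - 1) - (T x - x) * x"
      using fg[of "T x" x] by linarith
    then have "(ln (Z / m) - f x) * ?\<phi> x \<le> ((?\<phi> x / q (T x) - 1) - (T x - x) * x) * ?\<phi> x"
      by (rule mult_right_mono) simp
    then show ?thesis by (simp only: algebra_simps)
  qed
  have "((\<lambda>x. ln (Z / m) * ?\<phi> x - f x * ?\<phi> x) has_integral
     (ln (Z / m) * m - integral {-R..R} (\<lambda>x. f x * ?\<phi> x))) {-R..R}"
    unfolding m_def
    by (intro has_integral_diff has_integral_mult_right integrable_integral
        integrable_continuous_real continuous_intros f)
  from has_integral_le[OF this h' le]
  show "m * ln (Z / m) \<le> integral {-R..R} (\<lambda>x. f x * ?\<phi> x)" by (simp add: mult.commute)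
qed

section \<open>From symmetric intervals to the whole line\<close>

lemma prob_space_std_normal_distribution: "prob_space std_normal_distribution"
  by (rule prob_space_normal_density) simp

lemma std_normal_distribution_lborel:
  fixes f :: "real \<Rightarrow> real"
  assumes "f \<in> borel_measurable borel"
  shows "integrable std_normal_distribution f \<longleftrightarrow> integrable lborel (\<lambda>x. f x * std_normal_density x)"
    and "integral\<^sup>L std_normal_distribution f = integral\<^sup>L lborel (\<lambda>x. f x * std_normal_density x)"
  using assms
  by (simp_all add: integrable_density integral_density mult.commute)

lemma tendsto_integral_Icc_integral_UNIV:
  fixes w :: "real \<Rightarrow> real"
  assumes w: "continuous_on UNIV w" "integrable lborel w"
  shows "(\<lambda>n. integral {- real (Suc n)..real (Suc n)} w) \<longlonglongrightarrow> integral\<^sup>L lborel w"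
proof -
  have [measurable]: "w \<in> borel_measurable borel"
    by (intro borel_measurable_continuous_onI w)
  have "(\<lambda>n. LINT x|lborel. indicator {- real (Suc n)..real (Suc n)} x *\<^sub>R w x)
      \<longlonglongrightarrow> integral\<^sup>L lborel w"
  proof (rule integral_dominated_convergence[where w = "\<lambda>x. norm (w x)"])
    show "AE x in lborel. (\<lambda>n. indicator {- real (Suc n)..real (Suc n)} x *\<^sub>R w x) \<longlonglongrightarrow> w x"
    proof (rule AE_I2, rule tendsto_eventually)
      fix x :: real
      have "\<forall>\<^sub>F n in sequentially. \<bar>x\<bar> \<le> real n"
        using filterlim_real_sequentially unfolding filterlim_at_top by blast
      then show "\<forall>\<^sub>F n in sequentially. indicator {- real (Suc n)..real (Suc n)} x *\<^sub>R w x = w x"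
        by eventually_elim (auto simp: indicator_def)
    qed
  qed (use w in \<open>auto simp: indicator_def\<close>)
  moreover have "(LINT x|lborel. indicator {- real (Suc n)..real (Suc n)} x *\<^sub>R w x)
      = integral {- real (Suc n)..real (Suc n)} w" for n
    using set_borel_integral_eq_integral(2)[OF borel_integrable_atLeastAtMost', of _ _ w]
      continuous_on_subset[OF w(1)] by (simp add: set_lebesgue_integral_def)
  ultimately show ?thesis by simp
qed

text \<open>Let the interval grow: the Gaussian masses tend to 1, the integrals of \<open>f\<close>
  converge by domination, and those of \<open>exp g\<close> by monotone convergence. Integrability
  of \<open>exp g\<close> is not known beforehand, hence the nonnegative integral on the
  left.\<close>

lemma inf_convolution_std_normal_distribution:
  fixes f g :: "real \<Rightarrow> real"
  assumes f: "continuous_on UNIV f" and g: "continuous_on UNIV g"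
    and fg: "\<And>x y. g x - f y \<le> (x - y)\<^sup>2 / 2"
    and int_f: "integrable std_normal_distribution f"
  shows "(\<integral>\<^sup>+x. ennreal (exp (g x)) \<partial>std_normal_distribution)
    \<le> ennreal (exp (integral\<^sup>L std_normal_distribution f))"
proof -
  let ?\<phi> = std_normal_density
  \<comment> \<open>The successor makes every radius positive, as the interval version
    demands.\<close>
  define I where "I n = {- real (Suc n)..real (Suc n)}" for n
  define m where "m n = integral (I n) ?\<phi>" for n
  define Z where "Z n = integral (I n) (\<lambda>x. exp (g x) * ?\<phi> x)" for n
  define F where "F n = integral (I n) (\<lambda>x. f x * ?\<phi> x)" for n
  have [measurable]: "f \<in> borel_measurable borel" "g \<in> borel_measurable borel"
    by (intro borel_measurable_continuous_onI f g)+
  have m: "0 < m n" and Z: "0 < Z n" and mZ: "m n * ln (Z n / m n) \<le> F n" for n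
    using inf_convolution_gaussian_interval[of "real (Suc n)" f g]
      continuous_on_subset[OF f] continuous_on_subset[OF g] fg
    by (simp_all add: m_def Z_def F_def I_def)
  have Z_le: "Z n \<le> m n * exp (F n / m n)" for n
  proof -
    have "ln (Z n / m n) \<le> F n / m n"
      using mZ[of n] m[of n] by (simp add: pos_le_divide_eq mult.commute)
    then have "Z n / m n \<le> exp (F n / m n)"
      using Z[of n] m[of n] by (metis divide_pos_pos exp_le_cancel_iff exp_ln)
    then show ?thesis using m[of n] by (simp add: pos_divide_le_eq mult.commute)
  qed
  have "m \<longlonglongrightarrow> integral\<^sup>L lborel ?\<phi>"
    unfolding m_def[abs_def] I_def
    by (intro tendsto_integral_Icc_integral_UNIV continuous_intros integrable_normal_density) simp
  then have m_lim: "m \<longlonglongrightarrow> 1" by (simp add: integral_normal_density)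
  have F_lim: "F \<longlonglongrightarrow> integral\<^sup>L std_normal_distribution f"
    unfolding F_def[abs_def] I_def std_normal_distribution_lborel(2)[of f, simplified]
    using int_f by (intro tendsto_integral_Icc_integral_UNIV continuous_intros f)
      (simp add: std_normal_distribution_lborel)
  have "(\<lambda>n. m n * exp (F n / m n)) \<longlonglongrightarrow> 1 * exp (integral\<^sup>L std_normal_distribution f / 1)"
    by (intro tendsto_intros m_lim F_lim) simp
  then have rhs: "(\<lambda>n. ennreal (m n * exp (F n / m n)))
      \<longlonglongrightarrow> ennreal (exp (integral\<^sup>L std_normal_distribution f))"
    by (intro tendsto_ennrealI) simp
  let ?u = "\<lambda>n x. ennreal (indicator (I n) x * (exp (g x) * ?\<phi> x))"
  have I_mono: "x \<in> I n \<Longrightarrow> n \<le> k \<Longrightarrow> x \<in> I k" for x n k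
    unfolding I_def by auto
  have "(\<lambda>n. \<integral>\<^sup>+x. ?u n x \<partial>lborel) \<longlonglongrightarrow> (\<integral>\<^sup>+x. ennreal (exp (g x) * ?\<phi> x) \<partial>lborel)"
  proof (rule nn_integral_LIMSEQ)
    show "incseq ?u"
      by (intro incseq_SucI le_funI ennreal_leI)
         (auto simp: indicator_def dest: I_mono[OF _ le_SucI[OF order_refl]])
    show "?u n \<in> borel_measurable lborel" for n
      unfolding I_def by measurable
    show "(\<lambda>n. ?u n x) \<longlonglongrightarrow> ennreal (exp (g x) * ?\<phi> x)" for x
    proof (rule tendsto_eventually)
      have "\<forall>\<^sub>F n in sequentially. \<bar>x\<bar> \<le> real n"
        using filterlim_real_sequentially unfolding filterlim_at_top by blast
      then show "\<forall>\<^sub>F n in sequentially. ?u n x = ennreal (exp (g x) * ?\<phi> x)"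
        by eventually_elim (auto simp: indicator_def I_def)
    qed
  qed
  moreover have "(\<integral>\<^sup>+x. ?u n x \<partial>lborel) = ennreal (Z n)" for n
  proof -
    have si: "set_integrable lborel (I n) (\<lambda>x. exp (g x) * ?\<phi> x)"
      unfolding I_def
      by (intro borel_integrable_atLeastAtMost' continuous_intros continuous_on_subset[OF g]) simp
    from set_borel_integral_eq_integral(2)[OF si] si show ?thesis
      by (subst nn_integral_eq_integral)
         (auto simp: set_integrable_def set_lebesgue_integral_def Z_def)
  qed
  ultimately have "(\<lambda>n. ennreal (Z n)) \<longlonglongrightarrow> (\<integral>\<^sup>+x. ennreal (exp (g x) * ?\<phi> x) \<partial>lborel)"
    by simp
  then have "(\<integral>\<^sup>+x. ennreal (exp (g x) * ?\<phi> x) \<partial>lborel)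
      \<le> ennreal (exp (integral\<^sup>L std_normal_distribution f))"
    by (rule LIMSEQ_le[OF _ rhs]) (auto intro: Z_le ennreal_leI)
  moreover have "(\<integral>\<^sup>+x. ennreal (exp (g x)) \<partial>std_normal_distribution)
      = (\<integral>\<^sup>+x. ennreal (exp (g x) * ?\<phi> x) \<partial>lborel)"
    by (subst nn_integral_density) (auto intro!: nn_integral_cong simp: ennreal_mult' mult.commute)
  ultimately show ?thesis by simp
qed

subsection \<open>Tensorization\<close>

abbreviation std_normal_PiM :: "'i set \<Rightarrow> ('i \<Rightarrow> real) measure" where
  "std_normal_PiM I \<equiv> PiM I (\<lambda>_. std_normal_distribution)"

interpretation std_normal: prob_space std_normal_distribution
  by (rule prob_space_std_normal_distribution)

interpretation std_normal_prod: product_prob_space "\<lambda>_::'i. std_normal_distribution" UNIV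
  by unfold_locales

section \<open>Integrability of Lipschitz functions under Gaussian product measures\<close>

lemma integrable_std_normal_distribution_abs: "integrable std_normal_distribution (\<lambda>x. \<bar>x\<bar>)"
  using integrable_std_normal_moment_abs[of 1]
  by (simp add: std_normal_distribution_lborel mult.commute)

lemma lipschitz_imp_continuous_on_real:
  fixes w :: "real \<Rightarrow> real"
  assumes "\<And>x y. \<bar>w x - w y\<bar> \<le> L * \<bar>x - y\<bar>"
  shows "continuous_on UNIV w"
proof -
  have "0 \<le> L" using assms[of 0 1] by (simp add: order_trans[OF abs_ge_zero])
  then have "L-lipschitz_on UNIV w" using assms by (intro lipschitz_onI) (simp_all add: dist_real_def)
  then show ?thesis by (rule lipschitz_on_continuous_on)
qed

lemma integrable_std_normal_distribution_lipschitz: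
  fixes w :: "real \<Rightarrow> real"
  assumes "\<And>x y. \<bar>w x - w y\<bar> \<le> L * \<bar>x - y\<bar>"
  shows "integrable std_normal_distribution w"
proof (rule Bochner_Integration.integrable_bound)
  show "integrable std_normal_distribution (\<lambda>x. \<bar>w 0\<bar> + L * \<bar>x\<bar>)"
    by (intro Bochner_Integration.integrable_add integrable_mult_right
        integrable_std_normal_distribution_abs) simp
  show "w \<in> borel_measurable std_normal_distribution"
    using borel_measurable_continuous_onI[OF lipschitz_imp_continuous_on_real[OF assms]]
    by simp
  have "\<bar>w x\<bar> \<le> \<bar>\<bar>w 0\<bar> + L * \<bar>x\<bar>\<bar>" for x using assms[of x 0] by simp
  then show "AE x in std_normal_distribution. norm (w x) \<le> norm (\<bar>w 0\<bar> + L * \<bar>x\<bar>)" by simp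
qed

lemma integrable_std_normal_PiM_lipschitz:
  fixes f :: "('i \<Rightarrow> real) \<Rightarrow> real"
  assumes fin: "finite I"
    and meas: "f \<in> borel_measurable (std_normal_PiM I)"
    and lip: "\<And>x y. \<bar>f x - f y\<bar> \<le> L * (\<Sum>i\<in>I. \<bar>x i - y i\<bar>)"
  shows "integrable (std_normal_PiM I) f"
proof (rule Bochner_Integration.integrable_bound)
  have "integrable (std_normal_PiM I) (\<lambda>x. \<bar>x i\<bar>)" if "i \<in> I" for i
  proof -
    have "integrable (distr (std_normal_PiM I) std_normal_distribution (\<lambda>x. x i)) (\<lambda>x. \<bar>x\<bar>)"
      using integrable_std_normal_distribution_abs fin that
      by (subst distr_PiM_component[of I "\<lambda>_. std_normal_distribution"])
        (auto intro: prob_space_std_normal_distribution)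
    then show ?thesis
      by (rule integrable_distr[rotated]) (use that in measurable)
  qed
  then show "integrable (std_normal_PiM I) (\<lambda>x. \<bar>f (\<lambda>_. 0)\<bar> + L * (\<Sum>i\<in>I. \<bar>x i\<bar>))"
    by (intro Bochner_Integration.integrable_add integrable_mult_right
        Bochner_Integration.integrable_sum) 
      (auto intro!: finite_measure.integrable_const prob_space.finite_measure prob_space_PiM
        prob_space_std_normal_distribution)
  \<comment> \<open>The hypothesis \<open>lip\<close> covers all functions, so comparison with the
    zero function is legitimate although it need not be extensional on \<open>I\<close>.\<close>
  have "\<bar>f x\<bar> \<le> \<bar>\<bar>f (\<lambda>_. 0)\<bar> + L * (\<Sum>i\<in>I. \<bar>x i\<bar>)\<bar>" for x
    using lip[of x "\<lambda>_. 0"] by simp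
  then show "AE x in std_normal_PiM I. norm (f x) \<le> norm (\<bar>f (\<lambda>_. 0)\<bar> + L * (\<Sum>i\<in>I. \<bar>x i\<bar>))"
    by simp
qed (rule meas)

text \<open>Induction on the coordinates works because the quadratic cost is additive: the
  one-dimensional inequality in the new coordinate leaves a pair of functions of the others with the
  same relation. The Lipschitz hypotheses give continuity and integrability, and they survive the
  induction step.\<close>

lemma inf_convolution_std_normal_PiM:
  fixes f g :: "('i \<Rightarrow> real) \<Rightarrow> real"
  assumes "finite I"
    and "f \<in> borel_measurable (std_normal_PiM I)" "g \<in> borel_measurable (std_normal_PiM I)"
    and "\<And>x y. \<bar>f x - f y\<bar> \<le> L * (\<Sum>i\<in>I. \<bar>x i - y i\<bar>)"
    and "\<And>x y. \<bar>g x - g y\<bar> \<le> L * (\<Sum>i\<in>I. \<bar>x i - y i\<bar>)"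
    and "\<And>x y. g x - f y \<le> (\<Sum>i\<in>I. (x i - y i)\<^sup>2) / 2"
  shows "(\<integral>\<^sup>+x. ennreal (exp (g x)) \<partial>std_normal_PiM I)
    \<le> ennreal (exp (integral\<^sup>L (std_normal_PiM I) f))"
  using assms
proof (induction I arbitrary: f g rule: finite_induct)
  case empty
  then show ?case
    by (simp add: PiM_empty nn_integral_count_space_finite lebesgue_integral_count_space_finite
        ennreal_leI)
next
  case (insert i I)
  let ?N = std_normal_distribution
  note f_lip = insert.prems(3) and g_lip = insert.prems(4) and fg = insert.prems(5)
  have [measurable]: "f \<in> borel_measurable (std_normal_PiM (insert i I))"
    "g \<in> borel_measurable (std_normal_PiM (insert i I))" by fact+
  have upd [measurable]:
    "(\<lambda>(x, y). x(i := y)) \<in> std_normal_PiM I \<Otimes>\<^sub>M ?N \<rightarrow>\<^sub>M std_normal_PiM (insert i I)"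
    by (rule measurable_add_dim)
  have upd_f [measurable]: "(\<lambda>(x, y). f (x(i := y))) \<in> borel_measurable (std_normal_PiM I \<Otimes>\<^sub>M ?N)"
    and upd_g [measurable]: "(\<lambda>(x, y). g (x(i := y))) \<in> borel_measurable (std_normal_PiM I \<Otimes>\<^sub>M ?N)"
    using measurable_compose[OF upd, of f borel] measurable_compose[OF upd, of g borel]
    by (simp_all add: case_prod_beta' )
  have sum_upd: "(\<Sum>j\<in>insert i I. h ((x(i := y)) j) ((x'(i := y')) j))
      = h y y' + (\<Sum>j\<in>I. h (x j) (x' j))"
    for h :: "real \<Rightarrow> real \<Rightarrow> real" and x x' y y'
  proof -
    have "(\<Sum>j\<in>I. h ((x(i := y)) j) ((x'(i := y')) j)) = (\<Sum>j\<in>I. h (x j) (x' j))"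
      by (rule sum.cong) (use insert.hyps in auto)
    then show ?thesis using insert.hyps by simp
  qed
  have f_lip': "\<bar>f (x(i := y)) - f (x'(i := y'))\<bar> \<le> L * (\<bar>y - y'\<bar> + (\<Sum>j\<in>I. \<bar>x j - x' j\<bar>))"
    and g_lip': "\<bar>g (x(i := y)) - g (x'(i := y'))\<bar> \<le> L * (\<bar>y - y'\<bar> + (\<Sum>j\<in>I. \<bar>x j - x' j\<bar>))"
    and fg': "g (x(i := y)) - f (x'(i := y')) \<le> ((y - y')\<^sup>2 + (\<Sum>j\<in>I. (x j - x' j)\<^sup>2)) / 2" for x x' y y'
    using f_lip[of "x(i := y)" "x'(i := y')"] g_lip[of "x(i := y)" "x'(i := y')"]
      fg[of "x(i := y)" "x'(i := y')"]
    by (simp_all only: sum_upd[of "\<lambda>s t. \<bar>s - t\<bar>"] sum_upd[of "\<lambda>s t. (s - t)\<^sup>2"])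
  have f_int: "integrable ?N (\<lambda>y. f (x(i := y)))" for x
    by (rule integrable_std_normal_distribution_lipschitz) (use f_lip'[of x _ x] in simp)
  have g_cont: "continuous_on UNIV (\<lambda>y. g (x(i := y)))" for x
    by (rule lipschitz_imp_continuous_on_real) (use g_lip'[of x _ x] in simp)
  have g_meas [measurable]: "(\<lambda>y. g (x(i := y))) \<in> borel_measurable ?N" for x
    using borel_measurable_continuous_onI[OF g_cont] by simp
  \<comment> \<open>Integrating out the coordinate \<open>i\<close> preserves the hypotheses: see \<open>FG\<close> below.\<close>
  define F where "F x = (\<integral>y. f (x(i := y)) \<partial>?N)" for x
  define E where "E x = (\<integral>\<^sup>+y. ennreal (exp (g (x(i := y)))) \<partial>?N)" for x
  define G where "G x = ln (enn2real (E x))" for x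
  \<comment> \<open>For frozen \<open>x\<close> and \<open>x'\<close> the cost of the old
    coordinates is a constant; it is added to \<open>f\<close> before the one-dimensional inequality
    is applied.\<close>
  have E_le: "E x \<le> ennreal (exp (F x' + (\<Sum>j\<in>I. (x j - x' j)\<^sup>2) / 2))" for x x'
  proof -
    let ?c = "(\<Sum>j\<in>I. (x j - x' j)\<^sup>2) / 2"
    have "E x \<le> ennreal (exp (\<integral>y. f (x'(i := y)) + ?c \<partial>?N))"
      unfolding E_def
    proof (rule inf_convolution_std_normal_distribution)
      show "continuous_on UNIV (\<lambda>y. g (x(i := y)))" by (rule g_cont)
      have "continuous_on UNIV (\<lambda>y. f (x'(i := y)))"
        by (rule lipschitz_imp_continuous_on_real) (use f_lip'[of x' _ x'] in simp)
      then show "continuous_on UNIV (\<lambda>y. f (x'(i := y)) + ?c)" by (intro continuous_intros)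
      show "g (x(i := y)) - (f (x'(i := y')) + ?c) \<le> (y - y')\<^sup>2 / 2" for y y'
        using fg'[of x y x' y'] by (simp add: add_divide_distrib)
    qed (intro Bochner_Integration.integrable_add f_int, simp)
    also have "(\<integral>y. f (x'(i := y)) + ?c \<partial>?N) = F x' + ?c"
      by (subst Bochner_Integration.integral_add)
        (simp_all add: f_int F_def std_normal.prob_space[simplified])
    finally show ?thesis .
  qed
  \<comment> \<open>Positivity here and finiteness from \<open>E_le\<close> exclude the default
    values of \<open>enn2real\<close> and \<open>ln\<close> in \<open>G\<close>.\<close>
  have E_nz: "E x \<noteq> 0" for x
    unfolding E_def by (subst nn_integral_0_iff_AE) (simp_all add: not_le)
  have E_eq: "E x = ennreal (exp (G x))" for x
    using E_le[of x x] E_nz[of x] unfolding G_def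
    by (cases "E x") (auto simp: top_unique ennreal_eq_0_iff)
  have F_meas: "F \<in> borel_measurable (std_normal_PiM I)"
    unfolding F_def[abs_def]
    by (rule std_normal.borel_measurable_lebesgue_integral) (use upd_f in simp)
  have E_meas: "E \<in> borel_measurable (std_normal_PiM I)"
    unfolding E_def[abs_def]
    by (rule std_normal.borel_measurable_nn_integral) measurable
  have G_meas: "G \<in> borel_measurable (std_normal_PiM I)"
    unfolding G_def[abs_def] using E_meas by measurable
  have F_lip: "\<bar>F x - F x'\<bar> \<le> L * (\<Sum>j\<in>I. \<bar>x j - x' j\<bar>)" for x x'
  proof -
    have "F x - F x' = (\<integral>y. f (x(i := y)) - f (x'(i := y)) \<partial>?N)"
      unfolding F_def by (rule Bochner_Integration.integral_diff[symmetric]) (rule f_int)+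
    also have "\<bar>\<dots>\<bar> \<le> (\<integral>y. L * (\<Sum>j\<in>I. \<bar>x j - x' j\<bar>) \<partial>?N)"
    proof (rule Bochner_Integration.integral_abs_bound_integral)
      show "\<bar>f (x(i := y)) - f (x'(i := y))\<bar> \<le> L * (\<Sum>j\<in>I. \<bar>x j - x' j\<bar>)" for y
        using f_lip'[of x y x' y] by simp
    qed (auto intro: f_int)
    finally show ?thesis by (simp add: std_normal.prob_space[simplified])
  qed
  \<comment> \<open>Changing \<open>g\<close> by at most \<open>?d\<close> changes its integrated
    exponential by a factor of at most \<open>exp ?d\<close>.\<close>
  have G_le: "G x - G x' \<le> L * (\<Sum>j\<in>I. \<bar>x j - x' j\<bar>)" for x x'
  proof -
    let ?d = "L * (\<Sum>j\<in>I. \<bar>x j - x' j\<bar>)"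
    have "E x \<le> (\<integral>\<^sup>+y. ennreal (exp ?d) * ennreal (exp (g (x'(i := y)))) \<partial>?N)"
      unfolding E_def
    proof (rule nn_integral_mono)
      fix y
      have "g (x(i := y)) \<le> ?d + g (x'(i := y))" using g_lip'[of x y x' y] by simp
      then show "ennreal (exp (g (x(i := y)))) \<le> ennreal (exp ?d) * ennreal (exp (g (x'(i := y))))"
        by (simp add: ennreal_mult'[symmetric] exp_add[symmetric] ennreal_leI)
    qed
    also have "\<dots> = ennreal (exp ?d) * E x'"
      unfolding E_def
      by (rule nn_integral_cmult) measurable
    finally have "exp (G x) \<le> exp (?d + G x')"
      unfolding E_eq by (simp add: ennreal_mult'[symmetric] exp_add)
    then show ?thesis by simp
  qed
  have G_lip: "\<bar>G x - G x'\<bar> \<le> L * (\<Sum>j\<in>I. \<bar>x j - x' j\<bar>)" for x x'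
    using G_le[of x x'] G_le[of x' x] by (simp add: abs_minus_commute abs_le_iff)
  have FG: "G x - F x' \<le> (\<Sum>j\<in>I. (x j - x' j)\<^sup>2) / 2" for x x'
    using E_le[of x x'] unfolding E_eq by simp
  have "(\<integral>\<^sup>+x. ennreal (exp (g x)) \<partial>std_normal_PiM (insert i I)) = (\<integral>\<^sup>+x. E x \<partial>std_normal_PiM I)"
    unfolding E_def by (rule std_normal_prod.product_nn_integral_insert) (use insert.hyps in auto)
  also have "\<dots> = (\<integral>\<^sup>+x. ennreal (exp (G x)) \<partial>std_normal_PiM I)"
    by (simp add: E_eq)
  also have "\<dots> \<le> ennreal (exp (integral\<^sup>L (std_normal_PiM I) F))"
    by (rule insert.IH[OF F_meas G_meas F_lip G_lip FG])
  also have "integral\<^sup>L (std_normal_PiM I) F = integral\<^sup>L (std_normal_PiM (insert i I)) f"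
    unfolding F_def
    by (rule std_normal_prod.product_integral_insert[symmetric])
      (use insert.hyps insert.prems in \<open>auto intro!: integrable_std_normal_PiM_lipschitz\<close>)
  finally show ?case .
qed

subsection \<open>The Gaussian measure on vectors and concentration\<close>

lemma sets_std_gaussian [simp, measurable_cong]: "sets std_gaussian = sets borel"
  by (simp add: std_gaussian_def)

lemma space_std_gaussian [simp]: "space std_gaussian = UNIV"
  by (simp add: std_gaussian_def)

lemma measurable_std_normal_vec_density [measurable]:
  "std_normal_vec_density \<in> borel_measurable borel"
  unfolding std_normal_vec_density_def[abs_def] by measurable

lemma measurable_vec_nth_PiM [measurable]:
  "vec_nth \<in> borel \<rightarrow>\<^sub>M std_normal_PiM (UNIV :: 'n::finite set)"
  by (rule measurable_PiM_single') auto

lemma emeasure_std_gaussian_box: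
  fixes A :: "'n::finite \<Rightarrow> real set"
  assumes A: "\<And>i. A i \<in> sets borel"
  shows "emeasure std_gaussian {x. \<forall>i. x $ i \<in> A i} = (\<Prod>i\<in>UNIV. emeasure std_normal_distribution (A i))"
proof -
  let ?e = "\<lambda>i::'n. axis i (1::real)"
  let ?h = "\<lambda>i t. ennreal (std_normal_density t) * indicator (A i) t"
  note A [measurable]
  have inj: "inj ?e" by (auto intro: injI simp: axis_eq_axis)
  have Basis: "Basis = range ?e" by (auto simp: Basis_vec_def)
  have prod_Basis: "(\<Prod>b\<in>Basis. F b) = (\<Prod>i\<in>UNIV. F (?e i))" for F :: "real^'n \<Rightarrow> ennreal"
    unfolding Basis by (simp add: prod.reindex[OF inj])
  have "{x::real^'n. \<forall>i. x $ i \<in> A i} \<in> sets borel" by measurable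
  then have "emeasure std_gaussian {x. \<forall>i. x $ i \<in> A i}
    = (\<integral>\<^sup>+x. ennreal (std_normal_vec_density x) * indicator {x. \<forall>i. x $ i \<in> A i} x \<partial>lborel)"
    unfolding std_gaussian_def by (subst emeasure_density) auto
  \<comment> \<open>Lebesgue integrals of products factor over basis vectors;
    \<open>inv ?e b\<close> recovers the coordinate that belongs to \<open>b\<close>.\<close>
  also have "\<dots> = (\<integral>\<^sup>+x. (\<Prod>b\<in>Basis. ?h (inv ?e b) (x \<bullet> b)) \<partial>lborel)"
    by (intro nn_integral_cong, subst prod_Basis)
       (auto simp: inv_f_f[OF inj] inner_axis prod.distrib prod_ennreal indicator_def
          std_normal_vec_density_def)
  also have "\<dots> = (\<Prod>b\<in>Basis. \<integral>\<^sup>+t. ?h (inv ?e b) t \<partial>lborel)"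
    by (rule nn_integral_lborel_prod) auto
  also have "\<dots> = (\<Prod>i\<in>UNIV. emeasure std_normal_distribution (A i))"
    unfolding prod_Basis
    by (intro prod.cong refl) (simp add: inv_f_f[OF inj] emeasure_density)
  finally show ?thesis .
qed

lemma distr_std_gaussian_vec_nth:
  "distr std_gaussian (std_normal_PiM (UNIV :: 'n::finite set)) vec_nth = std_normal_PiM UNIV"
proof (rule std_normal_prod.PiM_eqI)
  fix A :: "'n \<Rightarrow> real set"
  assume "\<And>i. i \<in> UNIV \<Longrightarrow> A i \<in> sets std_normal_distribution"
  then have A: "A i \<in> sets borel" for i by simp
  have "vec_nth -` Pi\<^sub>E UNIV A = {x. \<forall>i. x $ i \<in> A i}" by auto
  moreover have "Pi\<^sub>E UNIV A \<in> sets (std_normal_PiM UNIV)"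
    using A by (intro sets_PiM_I_finite) auto
  ultimately show "emeasure (distr std_gaussian (std_normal_PiM UNIV) vec_nth) (Pi\<^sub>E UNIV A)
      = (\<Prod>i\<in>UNIV. emeasure std_normal_distribution (A i))"
    by (simp add: emeasure_distr emeasure_std_gaussian_box A)
qed auto

lemma prob_space_std_gaussian: "prob_space (std_gaussian :: (real^'n) measure)"
proof
  show "emeasure (std_gaussian :: (real^'n) measure) (space std_gaussian) = 1"
    using emeasure_std_gaussian_box[of "\<lambda>_::'n. UNIV"] std_normal.emeasure_space_1 by simp
qed

lemma measurable_vec_lambda_PiM [measurable]:
  "vec_lambda \<in> std_normal_PiM (UNIV :: 'n::finite set) \<rightarrow>\<^sub>M borel"
proof (subst borel_measurable_euclidean_space, rule ballI)
  fix b :: "real^'n" assume "b \<in> Basis"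
  then obtain i where "b = axis i 1" by (auto simp: Basis_vec_def)
  then have "(\<lambda>x. vec_lambda x \<bullet> b) = (\<lambda>x. x i)" by (simp add: inner_axis)
  then show "(\<lambda>x. vec_lambda x \<bullet> b) \<in> borel_measurable (std_normal_PiM UNIV)" by simp
qed

text \<open>Boxes determine a product measure, so the coordinates of a Gaussian vector have the
  product law. This carries the tensorized inequality over to functions on vectors.\<close>

lemma std_gaussian_eq_distr:
  "std_gaussian = distr (std_normal_PiM UNIV) borel vec_lambda"
proof -
  have "std_gaussian = distr std_gaussian borel (vec_lambda \<circ> vec_nth)"
    by (intro measure_eqI) (auto simp: emeasure_distr comp_def)
  also have "\<dots> = distr (distr std_gaussian (std_normal_PiM UNIV) vec_nth) borel vec_lambda"
    by (rule distr_distr[symmetric]) measurable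
  finally show ?thesis by (simp add: distr_std_gaussian_vec_nth)
qed

text \<open>The transport inequality for a multiple of \<open>f\<close>, and the same multiple
  lowered by a constant, bounds the exponential moment of \<open>f\<close>; Markov's inequality then
  gives the tail.\<close>

lemma gaussian_concentration_lower:
  fixes f :: "real^'n \<Rightarrow> real"
  assumes L: "0 < L" and lip: "\<And>x y. \<bar>f x - f y\<bar> \<le> L * norm (x - y)" and s: "0 \<le> s"
  shows "measure std_gaussian {x. f x \<le> integral\<^sup>L std_gaussian f - s} \<le> exp (- s\<^sup>2 / (2 * L\<^sup>2))"
proof -
  let ?P = "std_normal_PiM (UNIV :: 'n set)"
  let ?E = "integral\<^sup>L std_gaussian f"
  have "L-lipschitz_on UNIV f" using lip L by (intro lipschitz_onI) (simp_all add: dist_norm)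
  then have "continuous_on UNIV f" by (rule lipschitz_on_continuous_on)
  then have f_meas [measurable]: "f \<in> borel_measurable borel" by (rule borel_measurable_continuous_onI)
  define c where "c = - s / L\<^sup>2" \<comment> \<open>the optimal Chernoff exponent\<close>
  define F where "F x = c * f (vec_lambda x)" for x
  \<comment> \<open>By the inequality of arithmetic and geometric means, subtracting this constant
    turns the linear bound \<open>F_diff\<close> into the quadratic cost.\<close>
  define G where "G x = F x - c\<^sup>2 * L\<^sup>2 / 2" for x
  have [measurable]: "F \<in> borel_measurable ?P" "G \<in> borel_measurable ?P"
    unfolding F_def[abs_def] G_def[abs_def] by measurable
  have F_diff: "\<bar>F x - F y\<bar> \<le> \<bar>c\<bar> * L * norm (vec_lambda x - vec_lambda y :: real^'n)" for x y
    using mult_left_mono[OF lip[of "vec_lambda x" "vec_lambda y"], of "\<bar>c\<bar>"]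
    by (simp add: F_def abs_mult[symmetric] right_diff_distrib mult.assoc)
  have F_lip: "\<bar>F x - F y\<bar> \<le> (\<bar>c\<bar> * L) * (\<Sum>i\<in>UNIV. \<bar>x i - y i\<bar>)" for x y
  proof -
    have "norm (vec_lambda x - vec_lambda y :: real^'n) \<le> (\<Sum>i\<in>UNIV. \<bar>x i - y i\<bar>)"
      using norm_le_l1_cart[of "vec_lambda x - vec_lambda y :: real^'n"] by simp
    then show ?thesis
      using F_diff[of x y] L by (meson mult_left_mono order_trans mult_nonneg_nonneg abs_ge_zero less_imp_le)
  qed
  have FG: "G x - F y \<le> (\<Sum>i\<in>UNIV. (x i - y i)\<^sup>2) / 2" for x y
  proof -
    let ?n = "norm (vec_lambda x - vec_lambda y :: real^'n)"
    have "0 \<le> (\<bar>c\<bar> * L - ?n)\<^sup>2" by simp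
    then have "\<bar>c\<bar> * L * ?n \<le> ?n\<^sup>2 / 2 + c\<^sup>2 * L\<^sup>2 / 2"
      by (simp add: power2_diff power_mult_distrib)
    moreover have "?n\<^sup>2 = (\<Sum>i\<in>UNIV. (x i - y i)\<^sup>2)"
      by (simp add: norm_vec_def L2_set_def sum_nonneg)
    ultimately show ?thesis using F_diff[of x y] by (simp add: G_def)
  qed
  have "(\<integral>\<^sup>+x. ennreal (exp (G x)) \<partial>?P) \<le> ennreal (exp (integral\<^sup>L ?P F))"
    by (rule inf_convolution_std_normal_PiM[where L = "\<bar>c\<bar> * L"])
       (use F_lip FG in \<open>auto simp: G_def\<close>)
  also have "integral\<^sup>L ?P F = c * ?E"
    unfolding F_def by (simp add: std_gaussian_eq_distr integral_distr)
  finally have mgf: "(\<integral>\<^sup>+x. ennreal (exp (c * f x - c\<^sup>2 * L\<^sup>2 / 2)) \<partial>std_gaussian)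
      \<le> ennreal (exp (c * ?E))"
    by (simp add: std_gaussian_eq_distr nn_integral_distr G_def F_def)
  interpret prob_space "std_gaussian :: (real^'n) measure" by (rule prob_space_std_gaussian)
  let ?A = "{x. f x \<le> ?E - s}"
  have "?A \<in> sets borel" by measurable
  \<comment> \<open>Markov's inequality: since \<open>c\<close> is nonpositive, an upper bound on
    \<open>f\<close> is a lower bound on \<open>c * f x\<close>.\<close>
  then have "ennreal (exp (c * (?E - s) - c\<^sup>2 * L\<^sup>2 / 2)) * emeasure std_gaussian ?A
    = (\<integral>\<^sup>+x. ennreal (exp (c * (?E - s) - c\<^sup>2 * L\<^sup>2 / 2)) * indicator ?A x \<partial>std_gaussian)"
    by (subst nn_integral_cmult_indicator) auto
  also have "\<dots> \<le> (\<integral>\<^sup>+x. ennreal (exp (c * f x - c\<^sup>2 * L\<^sup>2 / 2)) \<partial>std_gaussian)"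
  proof (intro nn_integral_mono)
    fix x
    have "c \<le> 0" using s L by (simp add: c_def)
    then have "c * (?E - s) \<le> c * f x" if "x \<in> ?A" using that by (simp add: mult_left_mono_neg)
    then show "ennreal (exp (c * (?E - s) - c\<^sup>2 * L\<^sup>2 / 2)) * indicator ?A x
        \<le> ennreal (exp (c * f x - c\<^sup>2 * L\<^sup>2 / 2))"
      by (auto simp: indicator_def intro!: ennreal_leI)
  qed
  also note mgf
  finally have "exp (c * (?E - s) - c\<^sup>2 * L\<^sup>2 / 2) * measure std_gaussian ?A \<le> exp (c * ?E)"
    by (simp add: emeasure_eq_measure ennreal_mult'[symmetric])
  then have "measure std_gaussian ?A \<le> exp (c * ?E) / exp (c * (?E - s) - c\<^sup>2 * L\<^sup>2 / 2)"
    by (simp add: pos_le_divide_eq mult.commute)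
  also have "\<dots> = exp (c * s + c\<^sup>2 * L\<^sup>2 / 2)"
    by (simp add: exp_diff[symmetric] right_diff_distrib)
  also have "c * s + c\<^sup>2 * L\<^sup>2 / 2 = - s\<^sup>2 / (2 * L\<^sup>2)"
    using L by (simp add: c_def power2_eq_square field_simps)
  finally show ?thesis .
qed

subsection \<open>Coordinate reflections\<close>

definition flip_coords :: "'n set \<Rightarrow> real^'n \<Rightarrow> real^'n" where
  "flip_coords S x = (\<chi> i. if i \<in> S then - x $ i else x $ i)"

definition restrict_coords :: "'n set \<Rightarrow> real^'n \<Rightarrow> real^'n" where
  "restrict_coords S x = (\<chi> i. if i \<in> S then x $ i else 0)"

lemma flip_coords_flip_coords [simp]: "flip_coords S (flip_coords S x) = x"
  by (simp add: flip_coords_def vec_eq_iff)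

lemma flip_coords_eq: "flip_coords S x = x - 2 *\<^sub>R restrict_coords S x"
  by (simp add: flip_coords_def restrict_coords_def vec_eq_iff)

lemma norm_restrict_coords_flip_coords [simp]:
  "norm (restrict_coords S (flip_coords S' x)) = norm (restrict_coords S x)"
  unfolding norm_vec_def by (intro L2_set_cong) (simp_all add: restrict_coords_def flip_coords_def)

lemma continuous_on_restrict_coords [continuous_intros]:
  "continuous_on A (restrict_coords S :: real^'n \<Rightarrow> _)"
  by (rule continuous_on_subset[OF linear_continuous_on[of "restrict_coords S"] subset_UNIV])
     (auto intro!: linear_conv_bounded_linear[THEN iffD1] linearI
       simp: restrict_coords_def vec_eq_iff)

lemma measurable_flip_coords [measurable]: "flip_coords S \<in> borel \<rightarrow>\<^sub>M borel"
  unfolding flip_coords_eq by (intro borel_measurable_continuous_onI continuous_intros)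

text \<open>A flip is a diagonal map with entries 1 and -1: it preserves Lebesgue measure, and the
  density is even in each coordinate.\<close>

lemma distr_std_gaussian_flip_coords: 
  "distr std_gaussian borel (flip_coords S) = (std_gaussian :: (real^'n) measure)"
proof -
  \<comment> \<open>The diagonal entries, indexed by basis vectors to fit the affine change of
    variables.\<close>
  define c where "c j = (if \<exists>i\<in>S. j = axis i (1::real) then - 1 else 1 :: real)" for j :: "real^'n"
  have c_axis: "c (axis i 1) = (if i \<in> S then - 1 else 1)" for i
    by (auto simp: c_def axis_eq_axis)
  have "(0 + (\<Sum>j\<in>Basis. (c j * (x \<bullet> j)) *\<^sub>R j)) $ i = flip_coords S x $ i" for x i
  proof -
    have "(\<Sum>j\<in>Basis. (c j * (x \<bullet> j)) *\<^sub>R j) \<bullet> axis i 1 = c (axis i 1) * (x \<bullet> axis i 1)"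
      by (rule inner_sum_left_Basis) simp
    then show ?thesis by (simp add: c_axis inner_axis flip_coords_def)
  qed
  then have T: "(\<lambda>x. 0 + (\<Sum>j\<in>Basis. (c j * (x \<bullet> j)) *\<^sub>R j)) = flip_coords S"
    by (intro ext) (simp add: vec_eq_iff)
  have "(\<Prod>j\<in>Basis. \<bar>c j\<bar>) = 1" by (rule prod.neutral) (simp add: c_def)
  then have lborel: "lborel = distr lborel borel (flip_coords S)"
    using lborel_affine_euclidean[of c 0] unfolding T
    by (simp add: c_def density_1 flip: prod_ennreal)
  have even: "std_normal_vec_density (flip_coords S x) = std_normal_vec_density x" for x :: "real^'n"
    unfolding std_normal_vec_density_def
    by (intro prod.cong refl) (simp add: flip_coords_def std_normal_density_def)
  have "std_gaussian = density (distr lborel borel (flip_coords S)) (\<lambda>x. ennreal (std_normal_vec_density x))"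
    unfolding std_gaussian_def by (simp add: lborel[symmetric])
  also have "\<dots> = distr std_gaussian borel (flip_coords S)"
    unfolding std_gaussian_def by (subst density_distr) (simp_all add: even)
  finally show ?thesis by simp
qed

text \<open>Invariance of \<open>\<sigma>\<close> under flips means that each of the finitely many
  level sets of \<open>\<sigma>\<close> is mapped to itself, and on it a single measure-preserving
  flip acts.\<close>

lemma measure_preserving_flip_coords_choice:
  fixes \<sigma> :: "real^'n \<Rightarrow> 'n set"
  assumes \<sigma>: "\<And>S. {x. \<sigma> x = S} \<in> sets borel" and inv: "\<And>S x. \<sigma> (flip_coords S x) = \<sigma> x"
    and E: "E \<in> sets borel"
  shows "{x. flip_coords (\<sigma> x) x \<in> E} \<in> sets borel"
    and "emeasure std_gaussian {x. flip_coords (\<sigma> x) x \<in> E} = emeasure std_gaussian E"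
proof -
  define D where "D S = {x. \<sigma> x = S} \<inter> E" for S
  have D: "D S \<in> sets borel" for S unfolding D_def using \<sigma> E by blast
  have fD: "flip_coords S -` D S \<in> sets borel" for S
    using measurable_sets[OF measurable_flip_coords D] by simp
  have eq: "{x. flip_coords (\<sigma> x) x \<in> E} = (\<Union>S\<in>UNIV. flip_coords S -` D S)"
    by (auto simp: D_def inv)
  show "{x. flip_coords (\<sigma> x) x \<in> E} \<in> sets borel"
    unfolding eq by (intro sets.finite_UN) (use fD in auto)
  have "emeasure std_gaussian {x. flip_coords (\<sigma> x) x \<in> E}
      = (\<Sum>S\<in>UNIV. emeasure std_gaussian (flip_coords S -` D S))"
    unfolding eq
    by (rule sum_emeasure[symmetric]) (use fD in \<open>auto simp: disjoint_family_on_def D_def inv\<close>)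
  also have "\<dots> = (\<Sum>S\<in>UNIV. emeasure std_gaussian (D S))"
  proof (rule sum.cong[OF refl])
    fix S
    have "emeasure (distr std_gaussian borel (flip_coords S)) (D S)
        = emeasure std_gaussian (flip_coords S -` D S)"
      using D by (subst emeasure_distr) auto
    then show "emeasure std_gaussian (flip_coords S -` D S) = emeasure std_gaussian (D S)"
      by (simp add: distr_std_gaussian_flip_coords)
  qed
  also have "\<dots> = emeasure std_gaussian (\<Union>S\<in>UNIV. D S)"
    by (rule sum_emeasure) (use D in \<open>auto simp: disjoint_family_on_def D_def\<close>)
  also have "(\<Union>S\<in>UNIV. D S) = E" by (auto simp: D_def)
  finally show "emeasure std_gaussian {x. flip_coords (\<sigma> x) x \<in> E} = emeasure std_gaussian E" .
qed

text \<open>Serves to ensure that restricting a point to \<open>S\<close> gives a vector with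
  support exactly \<open>S\<close>, outside a null set.\<close>

lemma AE_std_gaussian_nth_neq_0: "AE x in std_gaussian. \<forall>i. (x :: real^'n) $ i \<noteq> 0"
proof -
  interpret prob_space "std_gaussian :: (real^'n) measure" by (rule prob_space_std_gaussian)
  have "emeasure std_normal_distribution (- {0}) = emeasure std_normal_distribution UNIV"
    by (rule emeasure_eq_AE) (auto simp: AE_density intro: AE_mp[OF AE_lborel_singleton[of 0]])
  then have "emeasure (std_gaussian :: (real^'n) measure) {x. \<forall>i. x $ i \<in> - {0}} = 1"
    using std_normal.emeasure_space_1 by (subst emeasure_std_gaussian_box) auto
  then have "prob {x. \<forall>i. x $ i \<noteq> 0} = 1" by (simp add: emeasure_eq_measure)
  then have "AE x in std_gaussian. x \<in> {x::real^'n. \<forall>i. x $ i \<noteq> 0}"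
    by (intro prob_eq_1[THEN iffD1]) (auto simp: sets_std_gaussian)
  then show ?thesis by simp
qed

subsection \<open>Highly symmetric sets\<close>

lemma inner_restrict_coords_vec_supp: "x \<bullet> t = restrict_coords (vec_supp t) x \<bullet> t"
  unfolding inner_vec_def by (intro sum.cong refl) (simp add: restrict_coords_def vec_supp_def)

lemma inradius_le_norm: "t \<in> T \<Longrightarrow> inradius T \<le> norm t"
  unfolding inradius_def by (intro cINF_lower bdd_belowI2[of _ 0]) auto

lemma abs_inner_scaled_le:
  assumes "t \<in> T" "0 < inradius T"
  shows "\<bar>x \<bullet> (t /\<^sub>R (norm t)\<^sup>2)\<bar> \<le> inverse (inradius T) * norm x"
proof -
  have t: "0 < norm t" by (rule less_le_trans[OF assms(2) inradius_le_norm[OF assms(1)]])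
  have "\<bar>x \<bullet> (t /\<^sub>R (norm t)\<^sup>2)\<bar> \<le> norm x * norm (t /\<^sub>R (norm t)\<^sup>2)" by (rule Cauchy_Schwarz_ineq2)
  also have "norm (t /\<^sub>R (norm t)\<^sup>2) = inverse (norm t)" using t by (simp add: power2_eq_square)
  also have "norm x * inverse (norm t) \<le> norm x * inverse (inradius T)"
    by (intro mult_left_mono le_imp_inverse_le inradius_le_norm assms) simp
  finally show ?thesis by (simp add: mult.commute)
qed

text \<open>With this bound the real-valued \<open>SUP\<close> over a nonempty \<open>T\<close> is a
  genuine supremum.\<close>

lemma bdd_above_inner_scaled:
  assumes "0 < inradius T"
  shows "bdd_above ((\<lambda>t. x \<bullet> (t /\<^sub>R (norm t)\<^sup>2)) ` T)"
  using abs_inner_scaled_le[OF _ assms, of _ x] by (intro bdd_aboveI2) (auto simp: abs_le_iff)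

lemma SUP_inner_scaled_lipschitz:
  fixes T :: "(real^'n) set"
  assumes T: "T \<noteq> {}" "0 < inradius T"
  defines "f \<equiv> \<lambda>x. SUP t\<in>T. x \<bullet> (t /\<^sub>R (norm t)\<^sup>2)"
  shows "\<bar>f x - f y\<bar> \<le> inverse (inradius T) * norm (x - y)"
proof -
  have "f x \<le> f y + inverse (inradius T) * norm (x - y)" for x y
    unfolding f_def
  proof (rule cSUP_least[OF T(1)])
    fix t assume t: "t \<in> T"
    have "x \<bullet> (t /\<^sub>R (norm t)\<^sup>2) = y \<bullet> (t /\<^sub>R (norm t)\<^sup>2) + (x - y) \<bullet> (t /\<^sub>R (norm t)\<^sup>2)"
      by (simp only: inner_diff_left)
    also have "\<dots> \<le> (SUP t\<in>T. y \<bullet> (t /\<^sub>R (norm t)\<^sup>2)) + inverse (inradius T) * norm (x - y)"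
      using abs_inner_scaled_le[OF t T(2), of "x - y"] 
      by (intro add_mono cSUP_upper[OF t bdd_above_inner_scaled[OF T(2)]]) (simp add: abs_le_iff)
    finally show "x \<bullet> (t /\<^sub>R (norm t)\<^sup>2)
      \<le> (SUP t\<in>T. y \<bullet> (t /\<^sub>R (norm t)\<^sup>2)) + inverse (inradius T) * norm (x - y)" .
  qed
  from this[of x y] this[of y x] show ?thesis by (simp add: abs_le_iff norm_minus_commute)
qed

text \<open>Since \<open>diff_scaled A r T\<close> need not be Borel, a Borel subset stands in for
  it. Positivity of \<open>r\<close> allows displacements to be divided by \<open>r\<close>.\<close>

lemma std_gaussian_subset_diff_scaled:
  fixes T A :: "(real ^ 'n) set" and u r :: real
  assumes T: "T \<noteq> {}" "highly_symmetric T" "0 < inradius T"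
    and u: "0 < u" and r: "0 < r" "r \<le> 2 * scaled_gaussian_width T - u / inradius T"
    and A: "A \<in> sets borel"
  obtains C where "C \<in> sets borel" "C \<subseteq> diff_scaled A r T"
    "measure std_gaussian A - exp (- u\<^sup>2 / 8) \<le> measure std_gaussian C"
proof -
  interpret prob_space "std_gaussian :: (real^'n) measure" by (rule prob_space_std_gaussian)
  let ?\<rho> = "inradius T"
  define f where "f x = (SUP t\<in>T. x \<bullet> (t /\<^sub>R (norm t)\<^sup>2))" for x
  have f_lip: "\<bar>f x - f y\<bar> \<le> inverse ?\<rho> * norm (x - y)" for x y
    unfolding f_def by (rule SUP_inner_scaled_lipschitz[OF T(1,3)])
  have w: "integral\<^sup>L std_gaussian f = scaled_gaussian_width T"
    by (simp add: f_def[abs_def] scaled_gaussian_width_def)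
  \<comment> \<open>The threshold is at least \<open>r / 2\<close> by the bound on \<open>r\<close>.
    With Lipschitz constant \<open>inverse ?\<rho>\<close>, the deviation
    \<open>u / (2 * ?\<rho>)\<close> yields the exponent \<open>- u\<^sup>2 / 8\<close>.\<close>
  define B where "B = {x. f x \<le> integral\<^sup>L std_gaussian f - u / (2 * ?\<rho>)}"
  have "measure std_gaussian B \<le> exp (- (u / (2 * ?\<rho>))\<^sup>2 / (2 * (inverse ?\<rho>)\<^sup>2))"
    unfolding B_def by (rule gaussian_concentration_lower[OF _ f_lip]) (use T u in auto)
  also have "- (u / (2 * ?\<rho>))\<^sup>2 / (2 * (inverse ?\<rho>)\<^sup>2) = - u\<^sup>2 / 8"
    using T by (simp add: power2_eq_square field_simps)
  finally have B_small: "measure std_gaussian B \<le> exp (- u\<^sup>2 / 8)" .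
  have "(inverse ?\<rho>)-lipschitz_on UNIV f"
    using f_lip T by (intro lipschitz_onI) (simp_all add: dist_norm)
  then have "continuous_on UNIV f" by (rule lipschitz_on_continuous_on)
  then have "closed B" unfolding B_def by (intro closed_Collect_le continuous_intros)
  then have B: "B \<in> sets borel" by (rule borel_closed)

  \<comment> \<open>The strict inequality makes \<open>{x. good S x}\<close> open, although \<open>T\<close> need not be Borel.\<close>
  define good where "good S x \<longleftrightarrow> (\<exists>t\<in>T. vec_supp t = S \<and> r * norm t < 2 * norm (restrict_coords S x))"
    for S :: "'n set" and x :: "real^'n"
  have "open {x. good S x}" for S
  proof -
    have "{x. good S x} = (\<Union>t\<in>{t\<in>T. vec_supp t = S}. {x. r * norm t < 2 * norm (restrict_coords S x)})"
      by (auto simp: good_def)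
    also have "open \<dots>"
      by (intro open_UN ballI open_Collect_less continuous_intros)
    finally show ?thesis .
  qed
  then have good_meas [measurable]: "Measurable.pred borel (good S)" for S
    using borel_open[of "{x. good S x}"] by (simp add: pred_def)
  \<comment> \<open>Goodness sees only the absolute values of the coordinates, which makes the
    choice \<open>\<sigma>\<close> flip-invariant.\<close>
  have good_flip: "good S (flip_coords S' x) = good S x" for S S' x by (simp add: good_def)
  \<comment> \<open>Where no set is good the value is arbitrary; every point of \<open>E\<close>
    below has a good set.\<close>
  define \<sigma> where "\<sigma> x = (SOME S. good S x)" for x
  have \<sigma>_flip: "\<sigma> (flip_coords S x) = \<sigma> x" for S x by (simp add: \<sigma>_def good_flip)
  have \<sigma>_meas: "{x. \<sigma> x = S} \<in> sets borel" for S
  proof -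
    \<comment> \<open>The choice depends on \<open>x\<close> only through its family of good sets,
      and there are finitely many families.\<close>
    have "{x. \<sigma> x = S} = (\<Union>\<S>\<in>{\<S>. (SOME S. S \<in> \<S>) = S}. {x. \<forall>S'\<in>UNIV. good S' x = (S' \<in> \<S>)})"
    proof (intro set_eqI iffI)
      fix x assume "x \<in> {x. \<sigma> x = S}"
      then show "x \<in> (\<Union>\<S>\<in>{\<S>. (SOME S. S \<in> \<S>) = S}. {x. \<forall>S'\<in>UNIV. good S' x = (S' \<in> \<S>)})"
        by (intro UN_I[of "{S. good S x}"]) (auto simp: \<sigma>_def)
    qed (auto simp: \<sigma>_def)
    also have "{x. \<forall>S'\<in>UNIV. good S' x = (S' \<in> \<S>)} \<in> sets borel" for \<S>
    proof -
      have "Measurable.pred borel (\<lambda>x. \<forall>S'\<in>UNIV. good S' x = (S' \<in> \<S>))"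
        by (intro pred_intros_finite) measurable
      then show ?thesis by (simp add: pred_def)
    qed
    then have "(\<Union>\<S>\<in>{\<S>. (SOME S. S \<in> \<S>) = S}. {x. \<forall>S'\<in>UNIV. good S' x = (S' \<in> \<S>)}) \<in> sets borel"
      by (intro sets.finite_UN) auto
    finally show ?thesis .
  qed

  define E where "E = A \<inter> {x. \<forall>i. x $ i \<noteq> 0} \<inter> - B"
  have nz: "{x::real^'n. \<forall>i. x $ i \<noteq> 0} \<in> sets borel" by measurable
  have E: "E \<in> sets borel" unfolding E_def using A B nz by auto
  define C where "C = {x. flip_coords (\<sigma> x) x \<in> E}"
  have C: "C \<in> sets borel" "measure std_gaussian C = measure std_gaussian E"
    using measure_preserving_flip_coords_choice[OF \<sigma>_meas \<sigma>_flip E]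
    by (simp_all add: C_def measure_def)
  have "C \<subseteq> diff_scaled A r T"
  proof
    fix y assume "y \<in> C"
    define x where "x = flip_coords (\<sigma> y) y"
    have x: "x \<in> A" "\<forall>i. x $ i \<noteq> 0" "x \<notin> B"
      using \<open>y \<in> C\<close> by (auto simp: C_def x_def E_def)
    \<comment> \<open>Flipping is an involution and \<open>\<sigma>\<close> agrees at
      \<open>x\<close> and \<open>y\<close>, so the same flip leads back.\<close>
    have y: "y = flip_coords (\<sigma> x) x" by (simp add: x_def \<sigma>_flip)
    have "u / (2 * ?\<rho>) = u / ?\<rho> / 2" by simp
    then have "r / 2 < f x" using x(3) r(2) by (simp add: B_def w)
    then obtain t where t: "t \<in> T" "r / 2 < x \<bullet> (t /\<^sub>R (norm t)\<^sup>2)"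
      unfolding f_def less_cSUP_iff[OF T(1) bdd_above_inner_scaled[OF T(3)]] by blast
    have t_pos: "0 < norm t" by (rule less_le_trans[OF T(3) inradius_le_norm[OF t(1)]])
    have "x \<bullet> (t /\<^sub>R (norm t)\<^sup>2) = (x \<bullet> t) / (norm t)\<^sup>2"
      by (simp add: divide_inverse mult.commute)
    then have "r / 2 * (norm t)\<^sup>2 < x \<bullet> t"
      using t(2) t_pos by (simp only: pos_less_divide_eq zero_less_power)
    \<comment> \<open>Cauchy-Schwarz is applied only on the support of \<open>t\<close>, so that the
      restricted norm appears.\<close>
    also have "\<dots> \<le> norm (restrict_coords (vec_supp t) x) * norm t"
      by (subst inner_restrict_coords_vec_supp) (rule norm_cauchy_schwarz)
    finally have "(r / 2 * norm t) * norm t < norm (restrict_coords (vec_supp t) x) * norm t"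
      by (simp only: power2_eq_square mult.assoc)
    then have "r / 2 * norm t < norm (restrict_coords (vec_supp t) x)"
      using t_pos by (simp only: mult_less_cancel_right_pos)
    then have "good (vec_supp t) x" unfolding good_def using t(1) by (intro bexI[of _ t]) auto
    then have "good (\<sigma> x) x" unfolding \<sigma>_def by (rule someI)
    \<comment> \<open>The chosen set may differ from the support of \<open>t\<close>, so it brings
      its own witness.\<close>
    then obtain t' where t': "t' \<in> T" "vec_supp t' = \<sigma> x"
      "r * norm t' < 2 * norm (restrict_coords (\<sigma> x) x)" by (auto simp: good_def)
    \<comment> \<open>Chosen so that \<open>r *\<^sub>R ?v\<close> is the displacement of the flip.
      It has the support of \<open>t'\<close> and at least its norm, so high symmetry puts it in
      \<open>T\<close>.\<close>
    let ?v = "(2 / r) *\<^sub>R restrict_coords (\<sigma> x) x"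
    have "vec_supp ?v = \<sigma> x"
      using x(2) r(1) by (auto simp: vec_supp_def restrict_coords_def)
    moreover have "norm t' \<le> norm ?v" using t'(3) r(1) by (simp add: field_simps)
    ultimately have "?v \<in> T" using T(2) t' unfolding highly_symmetric_def by metis
    moreover have "y = x - r *\<^sub>R ?v" using r(1) by (simp add: y flip_coords_eq)
    ultimately show "y \<in> diff_scaled A r T" using x(1) unfolding diff_scaled_def by blast
  qed
  moreover have "measure std_gaussian A - exp (- u\<^sup>2 / 8) \<le> measure std_gaussian C"
  proof -
    \<comment> \<open>Up to a null set, \<open>A\<close> is covered by \<open>E\<close> and
      \<open>B\<close>.\<close>
    have "measure std_gaussian A = measure std_gaussian (A \<inter> {x. \<forall>i. x $ i \<noteq> 0})"
      by (rule finite_measure_eq_AE) (use AE_std_gaussian_nth_neq_0 A nz in auto)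
    also have "\<dots> \<le> measure std_gaussian (E \<union> B)"
      by (rule finite_measure_mono) (use E B in \<open>auto simp: E_def\<close>)
    also have "\<dots> \<le> measure std_gaussian E + measure std_gaussian B"
      by (rule measure_Un_le) (use E B in auto)
    finally show ?thesis using B_small C(2) by simp
  qed
  ultimately show thesis using C(1) that by blast
qed

theorem theorem3p2:
  fixes M :: "'a measure" and X :: "'a \<Rightarrow> real ^ 'n"
    and T A :: "(real ^ 'n) set" and u r :: real
  assumes "prob_space M"
    and "std_normal_vec M X"
    and "T \<noteq> {}"
    and "highly_symmetric T"
    and "inradius T > 0"
    and "u > 0"
    and "0 \<le> r"
    and "r \<le> 2 * scaled_gaussian_width T - u / inradius T"
    and "A \<in> sets borel"
  shows "outer_prob M {\<omega> \<in> space M. X \<omega> \<in> diff_scaled A r T}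
           \<ge> measure M {\<omega> \<in> space M. X \<omega> \<in> A} - exp (- u\<^sup>2 / 8)"
proof -
  interpret prob_space M by fact
  obtain C where C: "C \<in> sets borel" "C \<subseteq> diff_scaled A r T"
    "measure std_gaussian A - exp (- u\<^sup>2 / 8) \<le> measure std_gaussian C"
  \<comment> \<open>For \<open>r = 0\<close> the difference set is \<open>A\<close> itself because
    \<open>T\<close> is nonempty.\<close>
  proof (cases "r = 0")
    case True
    then have "diff_scaled A r T = A" using assms(3) by (auto simp: diff_scaled_def)
    then show thesis using that[of A] assms(9) by simp
  next
    case False
    then show thesis
      using std_gaussian_subset_diff_scaled[OF assms(3,4,5,6) _ assms(8,9)] that assms(7) by force
  qed
  have X: "X \<in> M \<rightarrow>\<^sub>M lborel" and law: "distr M lborel X = std_gaussian"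
    using assms(2) by (auto simp: std_normal_vec_def distributed_def std_gaussian_def)
  have events: "{\<omega> \<in> space M. X \<omega> \<in> B} \<in> sets M"
    and prob: "measure M {\<omega> \<in> space M. X \<omega> \<in> B} = measure std_gaussian B" if "B \<in> sets borel" for B
  proof -
    have "{\<omega> \<in> space M. X \<omega> \<in> B} = X -` B \<inter> space M" by auto
    then show "{\<omega> \<in> space M. X \<omega> \<in> B} \<in> sets M"
      "measure M {\<omega> \<in> space M. X \<omega> \<in> B} = measure std_gaussian B"
      using that X by (simp_all add: law[symmetric] measure_distr measurable_sets)
  qed
  let ?D = "{\<omega> \<in> space M. X \<omega> \<in> diff_scaled A r T}"
  have "ennreal (measure std_gaussian C) = outer_measure_of M {\<omega> \<in> space M. X \<omega> \<in> C}"
    using events[OF C(1)] prob[OF C(1)] by (simp add: emeasure_eq_measure)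
  also have "\<dots> \<le> outer_measure_of M ?D" by (rule outer_measure_of_mono) (use C in auto)
  finally have "ennreal (measure std_gaussian C) \<le> outer_measure_of M ?D" .
  \<comment> \<open>Finiteness is needed because \<open>enn2real\<close> sends infinity to 0 and is
    monotone only below it.\<close>
  moreover have "outer_measure_of M ?D \<le> emeasure M (space M)"
    using outer_measure_of_mono[of ?D "space M" M] by auto
  then have "outer_measure_of M ?D < \<top>" unfolding emeasure_space_1 by (rule le_less_trans) simp
  ultimately have "enn2real (ennreal (measure std_gaussian C)) \<le> outer_prob M ?D"
    unfolding outer_prob_def by (rule enn2real_mono)
  then show ?thesis using C(3) prob[OF assms(9)] by simp
qed

end
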